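(* Let $R$ be an integral domain with quotient field $K$ and let $I$ be a strongly 2-absorbing primary ideal of $R$. Then: (a) If $J$ and $H$ are radical ideals of $R$, then $JH\subseteq I$ or $I^2\subseteq J\cup H$. (b) If $J$ and $I$ are prime ideals of $R$, then $J$ and $I$ are comparable (i.e. $J\subseteq I$ or $I\subseteq J$).
   Context: Let $R$ be an integral domain with quotient field $K$. An ideal $I$ of $R$ is a strongly 2-absorbing primary ideal if, whenever $xyz\in I$ for elements $x,y,z\in K$, we have either $xy\in I$ or $(yz)^n\in I$ or $(xz)^m\in I$ for some positive integers $n,m$. An ideal $J$ is radical if $\sqrt{J}=J$. Here $J\cup H$ is the set-theoretic union. *)

theory Defs
  imports "HOL-Algebra.Algebra"
begin

text \<open>
  A quotient field of a domain \<open>R\<close> is a field \<open>K\<close> together with an embedding \<open>\<iota>\<close> of \<open>R\<close>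
  into \<open>K\<close> such that every element of \<open>K\<close> is a fraction of elements of \<open>R\<close>.  The informal
  convention \<open>R \<subseteq> K\<close> is the case in which \<open>\<iota>\<close> is the identity; in general a subset \<open>I\<close> of \<open>R\<close>
  is viewed inside \<open>K\<close> as \<open>\<iota> ` I\<close>.
\<close>

definition quotient_field ::
  "('a, 'm) ring_scheme \<Rightarrow> ('b, 'n) ring_scheme \<Rightarrow> ('a \<Rightarrow> 'b) \<Rightarrow> bool" where
  "quotient_field R K \<iota> \<longleftrightarrow>
     domain R \<and> field K \<and> \<iota> \<in> ring_hom R K \<and> inj_on \<iota> (carrier R) \<and>
     (\<forall>x \<in> carrier K. \<exists>a \<in> carrier R. \<exists>b \<in> carrier R - {\<zero>\<^bsub>R\<^esub>}.
        x = \<iota> a \<otimes>\<^bsub>K\<^esub> inv\<^bsub>K\<^esub> (\<iota> b))"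

definition ideal_radical :: "('a, 'm) ring_scheme \<Rightarrow> 'a set \<Rightarrow> 'a set" where
  "ideal_radical R J = {x \<in> carrier R. \<exists>n::nat. n > 0 \<and> x [^]\<^bsub>R\<^esub> n \<in> J}"

definition radical_ideal :: "'a set \<Rightarrow> ('a, 'm) ring_scheme \<Rightarrow> bool" where
  "radical_ideal J R \<longleftrightarrow> ideal J R \<and> ideal_radical R J = J"

text \<open>As in the source, the ideal is not required to be proper.\<close>

definition strongly_2_absorbing_primary ::
  "'a set \<Rightarrow> ('a, 'm) ring_scheme \<Rightarrow> ('b, 'n) ring_scheme \<Rightarrow> ('a \<Rightarrow> 'b) \<Rightarrow> bool" where
  "strongly_2_absorbing_primary I R K \<iota> \<longleftrightarrow>
     ideal I R \<and>
     (\<forall>x \<in> carrier K. \<forall>y \<in> carrier K. \<forall>z \<in> carrier K.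
        x \<otimes>\<^bsub>K\<^esub> y \<otimes>\<^bsub>K\<^esub> z \<in> \<iota> ` I \<longrightarrow>
          x \<otimes>\<^bsub>K\<^esub> y \<in> \<iota> ` I \<or>
          (\<exists>n::nat. n > 0 \<and> (y \<otimes>\<^bsub>K\<^esub> z) [^]\<^bsub>K\<^esub> n \<in> \<iota> ` I) \<or>
          (\<exists>m::nat. m > 0 \<and> (x \<otimes>\<^bsub>K\<^esub> z) [^]\<^bsub>K\<^esub> m \<in> \<iota> ` I))"

end

theory Submission
  imports Defs
begin

text \<open>
  Let \<open>a \<in> J\<close>, \<open>b \<in> H\<close> with \<open>ab \<notin> I\<close>, and let \<open>w \<in> I\<close>.  Applying the defining property
  of \<open>I\<close> to the factorisation \<open>w = a \<cdot> b \<cdot> (w / ab)\<close> in \<open>K\<close> shows that a power of \<open>w / a\<close> or of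
  \<open>w / b\<close> lies in \<open>I\<close>, so a power of \<open>w\<close> lies in \<open>J\<close> or in \<open>H\<close>.  Hence \<open>JH \<subseteq> I\<close> or even
  \<open>I \<subseteq> J \<union> H\<close>.  Part (b) is the case \<open>H = J\<close>.
\<close>

text \<open>Here \<open>u\<close> plays the role of \<open>w / a\<close>. The equation is raised to
  the power \<open>n\<close> in \<open>K\<close> and pulled back along the injective
  \<open>\<iota>\<close>, which leaves a relation free of denominators.\<close>

lemma power_eq_mult_if_quotient_power_mem:
  assumes qf: "quotient_field R K \<iota>" and I: "ideal I R"
    and a: "a \<in> carrier R" and w: "w \<in> carrier R" and u: "u \<in> carrier K"
    and eq: "\<iota> a \<otimes>\<^bsub>K\<^esub> u = \<iota> w" and n: "u [^]\<^bsub>K\<^esub> (n::nat) \<in> \<iota> ` I"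
  shows "\<exists>i\<in>I. w [^]\<^bsub>R\<^esub> n = a [^]\<^bsub>R\<^esub> n \<otimes>\<^bsub>R\<^esub> i"
proof -
  interpret R: domain R using qf by (simp add: quotient_field_def)
  interpret K: field K using qf by (simp add: quotient_field_def)
  interpret h: ring_hom_cring R K \<iota>
    using qf by unfold_locales (simp add: quotient_field_def)
  obtain i where i: "i \<in> I" "u [^]\<^bsub>K\<^esub> n = \<iota> i" using n by auto
  have iR: "i \<in> carrier R" using i(1) I ideal.Icarr by fastforce
  have "\<iota> (w [^]\<^bsub>R\<^esub> n) = (\<iota> a \<otimes>\<^bsub>K\<^esub> u) [^]\<^bsub>K\<^esub> n"
    using w eq by simp
  also have "\<dots> = \<iota> (a [^]\<^bsub>R\<^esub> n \<otimes>\<^bsub>R\<^esub> i)"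
    using a u i iR by (simp add: K.nat_pow_distrib)
  finally have "w [^]\<^bsub>R\<^esub> n = a [^]\<^bsub>R\<^esub> n \<otimes>\<^bsub>R\<^esub> i"
    using qf a w iR by (intro inj_onD[of \<iota> "carrier R"]) (simp_all add: quotient_field_def)
  with i(1) show ?thesis by blast
qed

text \<open>Outcome of the factorisation \<open>w = a b z\<close>, with the denominators cleared:
  what follows from here on takes place in \<open>R\<close> alone.\<close>

lemma strongly_2_absorbing_primary_power_eq_mult:
  assumes qf: "quotient_field R K \<iota>" and s: "strongly_2_absorbing_primary I R K \<iota>"
    and a: "a \<in> carrier R" and b: "b \<in> carrier R" and ab: "a \<otimes>\<^bsub>R\<^esub> b \<notin> I" and w: "w \<in> I"
  shows "(\<exists>n::nat. n > 0 \<and> (\<exists>i\<in>I. w [^]\<^bsub>R\<^esub> n = a [^]\<^bsub>R\<^esub> n \<otimes>\<^bsub>R\<^esub> i)) \<or>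
         (\<exists>n::nat. n > 0 \<and> (\<exists>i\<in>I. w [^]\<^bsub>R\<^esub> n = b [^]\<^bsub>R\<^esub> n \<otimes>\<^bsub>R\<^esub> i))"
proof -
  interpret R: domain R using qf by (simp add: quotient_field_def)
  interpret K: field K using qf by (simp add: quotient_field_def)
  interpret h: ring_hom_cring R K \<iota>
    using qf by unfold_locales (simp add: quotient_field_def)
  have inj: "inj_on \<iota> (carrier R)" using qf by (simp add: quotient_field_def)
  have I: "ideal I R" using s by (simp add: strongly_2_absorbing_primary_def)
  interpret I: ideal I R by (rule I)
  have wR: "w \<in> carrier R" using w by (rule I.Icarr)
  \<comment> \<open>An ideal contains zero, so a product outside \<open>I\<close> is nonzero and may
    serve as a denominator.\<close>
  have "a \<otimes>\<^bsub>R\<^esub> b \<noteq> \<zero>\<^bsub>R\<^esub>" using ab I.zero_closed by metis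
  hence "\<iota> (a \<otimes>\<^bsub>R\<^esub> b) \<noteq> \<zero>\<^bsub>K\<^esub>"
    using inj_onD[OF inj, of "a \<otimes>\<^bsub>R\<^esub> b" "\<zero>\<^bsub>R\<^esub>"] a b by auto
  hence unit: "\<iota> a \<otimes>\<^bsub>K\<^esub> \<iota> b \<in> Units K" using a b K.field_Units by simp
  define z where "z = inv\<^bsub>K\<^esub> (\<iota> a \<otimes>\<^bsub>K\<^esub> \<iota> b) \<otimes>\<^bsub>K\<^esub> \<iota> w"
  have zK: "z \<in> carrier K" using unit wR by (simp add: z_def)
  have abz: "\<iota> a \<otimes>\<^bsub>K\<^esub> \<iota> b \<otimes>\<^bsub>K\<^esub> z = \<iota> w"
    unfolding z_def using unit a b wR
    by (subst K.m_assoc[symmetric]) (auto simp: K.Units_r_inv)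
  \<comment> \<open>This rules out the first of the three alternatives; injectivity of
    \<open>\<iota>\<close> carries the non-membership over to \<open>K\<close>.\<close>
  have "\<iota> a \<otimes>\<^bsub>K\<^esub> \<iota> b \<notin> \<iota> ` I"
    using ab a b inj_on_image_mem_iff[OF inj _ I.a_subset, of "a \<otimes>\<^bsub>R\<^esub> b"] by simp
  moreover have "\<iota> a \<otimes>\<^bsub>K\<^esub> \<iota> b \<in> \<iota> ` I \<or>
      (\<exists>n::nat. n > 0 \<and> (\<iota> b \<otimes>\<^bsub>K\<^esub> z) [^]\<^bsub>K\<^esub> n \<in> \<iota> ` I) \<or>
      (\<exists>n::nat. n > 0 \<and> (\<iota> a \<otimes>\<^bsub>K\<^esub> z) [^]\<^bsub>K\<^esub> n \<in> \<iota> ` I)"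
    using s[unfolded strongly_2_absorbing_primary_def, THEN conjunct2, rule_format,
        of "\<iota> a" "\<iota> b" z] a b zK abz w by simp
  ultimately consider n :: nat where "n > 0" "(\<iota> b \<otimes>\<^bsub>K\<^esub> z) [^]\<^bsub>K\<^esub> n \<in> \<iota> ` I"
    | n :: nat where "n > 0" "(\<iota> a \<otimes>\<^bsub>K\<^esub> z) [^]\<^bsub>K\<^esub> n \<in> \<iota> ` I"
    by blast
  then show ?thesis
  proof cases
    case 1
    \<comment> \<open>The roles cross over: \<open>b z\<close> is \<open>w / a\<close>, so a power
      of \<open>b z\<close> in \<open>I\<close> yields the factor \<open>a\<close>, and in the
      second case \<open>a z = w / b\<close> yields \<open>b\<close>.\<close>
    have "\<iota> a \<otimes>\<^bsub>K\<^esub> (\<iota> b \<otimes>\<^bsub>K\<^esub> z) = \<iota> w" using abz a b zK by (simp add: K.m_assoc)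
    with 1 show ?thesis
      using power_eq_mult_if_quotient_power_mem[OF qf I a wR _ _ 1(2)] b zK by auto
  next
    case 2
    have "\<iota> b \<otimes>\<^bsub>K\<^esub> (\<iota> a \<otimes>\<^bsub>K\<^esub> z) = \<iota> w" using abz a b zK by (simp add: K.m_ac)
    with 2 show ?thesis
      using power_eq_mult_if_quotient_power_mem[OF qf I b wR _ _ 2(2)] a zK by auto
  qed
qed

text \<open>The ideal absorbs the cofactor \<open>i\<close>, so it contains a positive power of
  \<open>w\<close>; being radical, it contains \<open>w\<close>.\<close>

lemma radical_ideal_mem_if_power_eq_mult:
  assumes J: "radical_ideal J R" and a: "a \<in> J" and w: "w \<in> carrier R" and i: "i \<in> carrier R"
    and n: "(n::nat) > 0" and eq: "w [^]\<^bsub>R\<^esub> n = a [^]\<^bsub>R\<^esub> n \<otimes>\<^bsub>R\<^esub> i"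
  shows "w \<in> J"
proof -
  interpret J: ideal J R using J by (simp add: radical_ideal_def)
  \<comment> \<open>The exponent must be positive: \<open>a^0\<close> is the unit, which need not
    lie in \<open>J\<close>.\<close>
  obtain k where k: "n = Suc k" using n by (cases n) auto
  have "a [^]\<^bsub>R\<^esub> n \<in> J" using a by (simp add: k J.I_l_closed J.Icarr)
  hence "w [^]\<^bsub>R\<^esub> n \<in> J" using i eq by (simp add: J.I_r_closed)
  hence "w \<in> ideal_radical R J" using w n by (auto simp: ideal_radical_def)
  thus ?thesis using J by (simp add: radical_ideal_def)
qed

text \<open>A single pair \<open>a\<close>, \<open>b\<close> with product outside \<open>I\<close>
  serves all \<open>w\<close> in \<open>I\<close>. Which of \<open>J\<close> and \<open>H\<close>
  receives \<open>w\<close> may vary with \<open>w\<close>, hence the union.\<close>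

lemma strongly_2_absorbing_primary_subset_Un_radical:
  assumes qf: "quotient_field R K \<iota>" and s: "strongly_2_absorbing_primary I R K \<iota>"
    and J: "radical_ideal J R" and H: "radical_ideal H R"
  shows "ideal_prod R J H \<subseteq> I \<or> I \<subseteq> J \<union> H"
proof (cases "\<forall>a\<in>J. \<forall>b\<in>H. a \<otimes>\<^bsub>R\<^esub> b \<in> I")
  case True
  interpret I: ideal I R using s by (simp add: strongly_2_absorbing_primary_def)
  \<comment> \<open>The product ideal consists of finite sums of products, so closure of
    \<open>I\<close> under addition suffices.\<close>
  have "x \<in> I" if "x \<in> ideal_prod R J H" for x
    using that by induction (use True in auto)
  thus ?thesis by blast
next
  case False
  then obtain a b where ab: "a \<in> J" "b \<in> H" "a \<otimes>\<^bsub>R\<^esub> b \<notin> I" by blast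
  interpret I: ideal I R using s by (simp add: strongly_2_absorbing_primary_def)
  have carr: "a \<in> carrier R" "b \<in> carrier R"
    using ab J H ideal.Icarr by (fastforce simp: radical_ideal_def)+
  have "w \<in> J \<union> H" if w: "w \<in> I" for w
    using strongly_2_absorbing_primary_power_eq_mult[OF qf s carr ab(3) w]
  proof (elim disjE exE conjE bexE)
    fix n :: nat and i
    assume "n > 0" "i \<in> I" "w [^]\<^bsub>R\<^esub> n = a [^]\<^bsub>R\<^esub> n \<otimes>\<^bsub>R\<^esub> i"
    then show ?thesis
      using radical_ideal_mem_if_power_eq_mult[OF J ab(1) I.Icarr I.Icarr] w by simp
  next
    fix n :: nat and i
    assume "n > 0" "i \<in> I" "w [^]\<^bsub>R\<^esub> n = b [^]\<^bsub>R\<^esub> n \<otimes>\<^bsub>R\<^esub> i"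
    then show ?thesis
      using radical_ideal_mem_if_power_eq_mult[OF H ab(2) I.Icarr I.Icarr] w by simp
  qed
  thus ?thesis by blast
qed

lemma primeideal_imp_radical_ideal:
  assumes "primeideal J R"
  shows "radical_ideal J R"
proof -
  interpret J: primeideal J R by fact
  have pow: "x \<in> J" if x: "x \<in> carrier R" and "x [^]\<^bsub>R\<^esub> (n::nat) \<in> J" for x n
    using that(2)
  proof (induction n)
    \<comment> \<open>Here \<open>x^0\<close> is the unit, and its membership would contradict
      properness of the prime ideal.\<close>
    case 0
    then show ?case using J.one_imp_carrier J.I_notcarr by simp
  next
    case (Suc n)
    then show ?case using J.I_prime[of "x [^]\<^bsub>R\<^esub> n" x] x by auto
  qed
  have "ideal_radical R J = J"
  proof
    show "ideal_radical R J \<subseteq> J" using pow by (auto simp only: ideal_radical_def)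
    show "J \<subseteq> ideal_radical R J"
    proof
      fix x assume x: "x \<in> J"
      hence "x [^]\<^bsub>R\<^esub> (1::nat) \<in> J" using J.Icarr by simp
      thus "x \<in> ideal_radical R J"
        unfolding ideal_radical_def using x J.Icarr zero_less_one by blast
    qed
  qed
  thus ?thesis using J.is_ideal by (simp add: radical_ideal_def)
qed

theorem theorem2p7:
  fixes R :: "('a, 'm) ring_scheme" and K :: "('b, 'n) ring_scheme"
    and \<iota> :: "'a \<Rightarrow> 'b" and I :: "'a set"
  assumes "domain R"
    and "quotient_field R K \<iota>"
    and "strongly_2_absorbing_primary I R K \<iota>"
  shows "(\<forall>J H. radical_ideal J R \<and> radical_ideal H R \<longrightarrow>
            ideal_prod R J H \<subseteq> I \<or> ideal_prod R I I \<subseteq> J \<union> H) \<and>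
         (\<forall>J. primeideal J R \<and> primeideal I R \<longrightarrow> J \<subseteq> I \<or> I \<subseteq> J)"
proof (intro conjI allI impI; elim conjE)
  interpret domain R by fact
  have I: "ideal I R" using assms(3) by (simp add: strongly_2_absorbing_primary_def)
  fix J H assume "radical_ideal J R" "radical_ideal H R"
  \<comment> \<open>The inclusion of \<open>I\<close> itself in the union is stronger than the one
    claimed for its square.\<close>
  moreover have "ideal_prod R I I \<subseteq> I" using ideal_prod_inter[OF I I] by blast
  ultimately show "ideal_prod R J H \<subseteq> I \<or> ideal_prod R I I \<subseteq> J \<union> H"
    using strongly_2_absorbing_primary_subset_Un_radical[OF assms(2,3)] by blast
next
  fix J assume J: "primeideal J R" and I: "primeideal I R"
  \<comment> \<open>With \<open>H = J\<close> the first alternative bounds only the square of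
    \<open>J\<close>; primality of \<open>I\<close> removes the square.\<close>
  have "J \<subseteq> I" if JJ: "ideal_prod R J J \<subseteq> I"
  proof
    fix x assume x: "x \<in> J"
    have "x \<otimes>\<^bsub>R\<^esub> x \<in> I" using JJ ideal_prod.prod[OF x x] by blast
    moreover have "x \<in> carrier R" using x J ideal.Icarr primeideal.axioms(1) by fastforce
    ultimately show "x \<in> I" using primeideal.I_prime[OF I] by blast
  qed
  then show "J \<subseteq> I \<or> I \<subseteq> J"
    using strongly_2_absorbing_primary_subset_Un_radical[OF assms(2,3)]
      primeideal_imp_radical_ideal[OF J] by blast
qed

end
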